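(* Let $\Phi$ be a virtually Abelian group and $\tilde{\Phi} \leq \Phi$ a normal Abelian subgroup of index $k < \infty$. Let $S \subset \Phi$ be a finite, symmetric generating set of $\Phi$ and denote by $G = \mathrm{Cay}(\Phi,S)$ the associated Cayley graph. Similarly, let $\tilde{S} \subset \tilde{\Phi}$ be a finite, symmetric generating set of $\tilde{\Phi}$ that is invariant under conjugation by elements of $\Phi$. Then there exist constants $K, C > 0$ such that for any solution $w : G \times [0,\infty) \to [0,1]$ of the heat equation $\Delta w = \partial_t w$ on $G$, the shifted solution $u = w + \sqrt{k}$ satisfies $$\frac{\widetilde{\Gamma}(\sqrt{u})}{K u} - \frac{\partial_t(\sqrt{u})}{\sqrt{u}} \leq \frac{C}{t}$$ at every $x \in G$ and every $t > 0$.
   Context: Edges of Cayley graphs are given by right multiplication by generators: $x$ is adjacent to $x*s$, $s \in S$. The graph $\tilde{G} = \mathrm{Cay}(\Phi, \tilde{S})$ has the same vertex set $\Phi$ as $G$, with edges given by right multiplication by elements of $\tilde{S}$ (it is a disjoint union of finitely many copies of $\mathrm{Cay}(\tilde{\Phi},\tilde{S})$). For a locally finite graph $G$ and a function $f : G \to \mathbb{R}$ on its vertices, $\Delta f(x) = \Delta_G f(x) = \sum_{y \sim x} (f(y) - f(x))$ and $\Gamma_G(f)(x) = \sum_{y \sim x} (f(y)-f(x))^2$. Write $\widetilde{\Gamma} = \Gamma_{\tilde{G}}$. These operators act on the space variable $x$ of functions of $(x,t)$. *)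

theory Defs
  imports "HOL-Algebra.Generated_Groups" "HOL-Analysis.Analysis"
begin

definition symmetric_generating_set :: "('a, 'b) monoid_scheme \<Rightarrow> 'a set \<Rightarrow> 'a set \<Rightarrow> bool"
  where "symmetric_generating_set G H S \<longleftrightarrow>
    S \<subseteq> H \<and> (\<forall>s\<in>S. inv\<^bsub>G\<^esub> s \<in> S) \<and> generate G S = H"

text \<open>A graph is represented by its edge relation. \<open>S\<close> may contain the identity; the resulting
  loops contribute nothing to either operator below.\<close>

definition cayley_edges :: "('a, 'b) monoid_scheme \<Rightarrow> 'a set \<Rightarrow> 'a rel"
  where "cayley_edges G S = {(x, x \<otimes>\<^bsub>G\<^esub> s) | x s. x \<in> carrier G \<and> s \<in> S}"

definition graph_laplacian :: "'a rel \<Rightarrow> ('a \<Rightarrow> real) \<Rightarrow> 'a \<Rightarrow> real"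
  where "graph_laplacian E f x = (\<Sum>y\<in>E `` {x}. f y - f x)"

definition graph_gamma :: "'a rel \<Rightarrow> ('a \<Rightarrow> real) \<Rightarrow> 'a \<Rightarrow> real"
  where "graph_gamma E f x = (\<Sum>y\<in>E `` {x}. (f y - f x)\<^sup>2)"

text \<open>The equation is required on all of \<open>[0,\<infinity>)\<close>, so the time derivative at \<open>0\<close> is one-sided.\<close>

definition heat_solution :: "'a set \<Rightarrow> 'a rel \<Rightarrow> ('a \<Rightarrow> real \<Rightarrow> real) \<Rightarrow> bool"
  where "heat_solution V E w \<longleftrightarrow>
    (\<forall>x\<in>V. \<forall>t\<ge>0.
      (w x has_real_derivative graph_laplacian E (\<lambda>y. w y t) x) (at t within {0..}))"

end

theory Submission
  imports Defs
begin

text \<open>The shift puts \<open>u\<close> above \<open>1\<close>, so it suffices to bound, for bounded solutions \<open>w\<close>, the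
  differences \<open>w (x s) - w x\<close> by \<open>C / sqrt t\<close> and the Laplacian of \<open>w\<close> by \<open>C / t\<close>.

  Left translations by the normal subgroup \<open>N\<close> commute with the heat flow, so Bernstein's method and
  the maximum principle bound differences along \<open>N\<close>, and also the Laplacian itself, by \<open>C / sqrt t\<close>.
  Smallness of the Laplacian and of the \<open>N\<close>-differences then controls the differences across the
  finitely many cosets. Finally, the sum of the Laplacian over a transversal of \<open>N\<close> has no
  first-order term, by the symmetry of the generating set; second-order differences are \<open>C / t\<close> by
  the semigroup property, and so is the variation of the Laplacian between cosets, hence the
  Laplacian at each point.\<close>

lemma power2_add_le: "(a + b)\<^sup>2 \<le> 2 * a\<^sup>2 + 2 * (b\<^sup>2 :: real)"
  using zero_le_power2[of "a - b"] by (simp add: power2_eq_square algebra_simps)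

section \<open>Laplacian and squared gradient on a Cayley graph\<close>

locale cayley_heat = group G for G (structure) +
  fixes S :: "'a set"
  assumes fin_S: "finite S" and S_sub: "S \<subseteq> carrier G"
    and S_inv: "\<And>s. s \<in> S \<Longrightarrow> inv s \<in> S" and S_gen: "generate G S = carrier G"
begin

abbreviation lap :: "('a \<Rightarrow> real) \<Rightarrow> 'a \<Rightarrow> real"
  where "lap \<equiv> graph_laplacian (cayley_edges G S)"

abbreviation gam :: "('a \<Rightarrow> real) \<Rightarrow> 'a \<Rightarrow> real"
  where "gam \<equiv> graph_gamma (cayley_edges G S)"

abbreviation sol :: "('a \<Rightarrow> real \<Rightarrow> real) \<Rightarrow> bool"
  where "sol \<equiv> heat_solution (carrier G) (cayley_edges G S)"

lemma S_carrier [simp]: "s \<in> S \<Longrightarrow> s \<in> carrier G"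
  using S_sub by blast

lemma cayley_sum:
  assumes "x \<in> carrier G" "A \<subseteq> carrier G"
  shows "sum h (cayley_edges G A `` {x}) = (\<Sum>s\<in>A. h (x \<otimes> s))"
proof -
  have "cayley_edges G A `` {x} = (\<lambda>s. x \<otimes> s) ` A"
    using assms by (auto simp: cayley_edges_def)
  moreover have "inj_on (\<lambda>s. x \<otimes> s) A"
    using assms by (intro inj_onI) (metis Units_eq Units_l_cancel subsetD)
  ultimately show ?thesis by (simp add: sum.reindex)
qed

lemma lap_eq: "x \<in> carrier G \<Longrightarrow> lap g x = (\<Sum>s\<in>S. g (x \<otimes> s) - g x)"
  by (simp add: graph_laplacian_def cayley_sum S_sub)

lemma gam_eq: "x \<in> carrier G \<Longrightarrow> gam g x = (\<Sum>s\<in>S. (g (x \<otimes> s) - g x)\<^sup>2)"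
  by (simp add: graph_gamma_def cayley_sum S_sub)

lemma gam_nonneg: "gam g x \<ge> 0"
  by (simp add: graph_gamma_def sum_nonneg)

lemma lap_power2:
  assumes "x \<in> carrier G"
  shows "lap (\<lambda>y. (g y)\<^sup>2) x = 2 * g x * lap g x + gam g x"
  using assms by (simp add: lap_eq gam_eq sum_distrib_left flip: sum.distrib)
    (simp add: power2_eq_square algebra_simps)

lemma solD:
  "sol f \<Longrightarrow> x \<in> carrier G \<Longrightarrow> t \<ge> 0 \<Longrightarrow>
    (f x has_real_derivative lap (\<lambda>y. f y t) x) (at t within {0..})"
  by (simp add: heat_solution_def)

text \<open>Symmetry of \<open>S\<close> turns the inverse case of \<open>generate\<close> into
  another generator step. The induction shows that multiplication by \<open>c\<close> preserves
  \<open>P\<close>, a claim that composes along products.\<close>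

lemma word_induct_left [consumes 1, case_names one step]:
  assumes "c \<in> carrier G" and one: "P \<one>"
    and step: "\<And>s d. s \<in> S \<Longrightarrow> d \<in> carrier G \<Longrightarrow> P d \<Longrightarrow> P (s \<otimes> d)"
  shows "P c"
proof -
  have "c \<in> carrier G \<and> (\<forall>d\<in>carrier G. P d \<longrightarrow> P (c \<otimes> d))" if "c \<in> generate G S" for c
    using that by (induction rule: generate.induct) (auto simp: step S_inv m_assoc)
  then show ?thesis
    using assms(1) one by (metis S_gen one_closed r_one)
qed

lemma word_induct_right [consumes 1, case_names one step]:
  assumes "c \<in> carrier G" and one: "P \<one>"
    and step: "\<And>s d. s \<in> S \<Longrightarrow> d \<in> carrier G \<Longrightarrow> P d \<Longrightarrow> P (d \<otimes> s)"
  shows "P c"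
proof -
  have "c \<in> carrier G \<and> (\<forall>d\<in>carrier G. P d \<longrightarrow> P (d \<otimes> c))" if "c \<in> generate G S" for c
    using that by (induction rule: generate.induct) (auto simp: step S_inv simp flip: m_assoc)
  then show ?thesis
    using assms(1) one by (metis S_gen one_closed l_one)
qed


subsection \<open>Maximum principle\<close>

text \<open>A maximum need not be attained on an infinite graph. Instead,
  \<open>exp (D * \<tau>) * (v x \<tau> - M)\<close> is nonincreasing in \<open>\<tau>\<close>,
  because the bound \<open>M\<close> at the neighbours gives
  \<open>v' + D * (v - M) \<le> 0\<close>. This pulls the upper bound from \<open>M\<close> towards
  \<open>m\<close> by a factor uniform in \<open>x\<close>.\<close>

lemma max_principle_step:
  fixes v v' :: "'a \<Rightarrow> real \<Rightarrow> real"
  assumes der: "\<And>x t. x \<in> carrier G \<Longrightarrow> t \<ge> 0 \<Longrightarrow>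
      (v x has_real_derivative v' x t) (at t within {0..})"
    and sub: "\<And>x t. x \<in> carrier G \<Longrightarrow> t \<ge> 0 \<Longrightarrow> v' x t \<le> lap (\<lambda>y. v y t) x"
    and bd: "\<And>x t. x \<in> carrier G \<Longrightarrow> 0 \<le> t \<Longrightarrow> t \<le> T \<Longrightarrow> v x t \<le> M"
    and init: "\<And>x. x \<in> carrier G \<Longrightarrow> v x 0 \<le> m"
    and "m \<le> M" "0 \<le> t" "t \<le> T" "x \<in> carrier G"
  shows "v x t \<le> m + (M - m) * (1 - exp (- (real (card S) * T)))"
proof -
  define D where "D = real (card S)"
  define g where "g = (\<lambda>\<tau>. exp (D * \<tau>) * (v x \<tau> - M))"
  have dg: "(g has_real_derivative exp (D * \<tau>) * (v' x \<tau> + D * (v x \<tau> - M))) (at \<tau> within {0..t})"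
    if "\<tau> \<in> {0..t}" for \<tau>
  proof -
    have "(v x has_real_derivative v' x \<tau>) (at \<tau> within {0..t})"
      using that assms by (intro DERIV_subset[OF der[of x \<tau>]]) auto
    then show ?thesis unfolding g_def
      by (auto intro!: derivative_eq_intros simp: algebra_simps)
  qed
  have neg: "exp (D * \<tau>) * (v' x \<tau> + D * (v x \<tau> - M)) \<le> 0" if "\<tau> \<in> {0..t}" for \<tau>
  proof -
    have "v' x \<tau> \<le> (\<Sum>s\<in>S. v (x \<otimes> s) \<tau> - v x \<tau>)"
      using sub[of x \<tau>] that assms by (simp add: lap_eq)
    also have "\<dots> \<le> (\<Sum>s\<in>S. M - v x \<tau>)"
      using that assms by (intro sum_mono diff_right_mono bd) auto
    finally have "v' x \<tau> + D * (v x \<tau> - M) \<le> 0"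
      by (simp add: D_def algebra_simps)
    then show ?thesis by (simp add: mult_nonneg_nonpos)
  qed
  have "g t \<le> g 0"
  proof (cases "t = 0")
    case False
    then obtain \<xi> where \<xi>: "\<xi> \<in> {0..t}"
      "g t - g 0 = (t - 0) * (exp (D * \<xi>) * (v' x \<xi> + D * (v x \<xi> - M)))"
      using mvt_very_simple[of 0 t g "\<lambda>\<tau> h. h * (exp (D * \<tau>) * (v' x \<tau> + D * (v x \<tau> - M)))"]
        dg assms by (auto simp: has_field_derivative_def mult.commute[of _ "exp _ * _"])
    then show ?thesis
      using mult_nonneg_nonpos[OF assms(6) neg[OF \<xi>(1)]] by simp
  qed simp
  also have "\<dots> \<le> m - M"
    using init[of x] assms by (simp add: g_def)
  finally have "exp (- (D * t)) * (exp (D * t) * (v x t - M)) \<le> exp (- (D * t)) * (m - M)"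
    unfolding g_def by (intro mult_left_mono) auto
  then have "v x t \<le> M + exp (- (D * t)) * (m - M)"
    by (simp add: right_diff_distrib flip: mult.assoc exp_add)
  also have "exp (- (D * t)) * (m - M) \<le> exp (- (D * T)) * (m - M)"
    using assms by (intro mult_right_mono_neg) (auto simp: D_def mult_left_mono)
  finally show ?thesis by (simp add: D_def algebra_simps)
qed

text \<open>Each application of the one-step estimate multiplies the excess over \<open>m\<close> by
  \<open>q < 1\<close>, so the excess vanishes in the limit.\<close>

lemma max_principle:
  fixes v v' :: "'a \<Rightarrow> real \<Rightarrow> real"
  assumes der: "\<And>x t. x \<in> carrier G \<Longrightarrow> t \<ge> 0 \<Longrightarrow>
      (v x has_real_derivative v' x t) (at t within {0..})"
    and sub: "\<And>x t. x \<in> carrier G \<Longrightarrow> t \<ge> 0 \<Longrightarrow> v' x t \<le> lap (\<lambda>y. v y t) x"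
    and bd: "\<And>x t. x \<in> carrier G \<Longrightarrow> 0 \<le> t \<Longrightarrow> t \<le> T \<Longrightarrow> v x t \<le> M"
    and init: "\<And>x. x \<in> carrier G \<Longrightarrow> v x 0 \<le> m"
    and "0 \<le> T" "x \<in> carrier G"
  shows "v x T \<le> m"
proof -
  \<comment> \<open>The one-step estimate needs \<open>m \<le> M'\<close>, which is not assumed of
    \<open>M\<close>.\<close>
  define M' where "M' = max M m"
  define q where "q = 1 - exp (- (real (card S) * T))"
  have q: "0 \<le> q" "q < 1" using assms by (auto simp: q_def)
  have *: "\<forall>x\<in>carrier G. \<forall>t\<in>{0..T}. v x t \<le> m + (M' - m) * q ^ j" for j
  proof (induction j)
    case 0
    then show ?case using bd by (force simp: M'_def)
  next
    case (Suc j)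
    have "v x t \<le> m + ((m + (M' - m) * q ^ j) - m) * (1 - exp (- (real (card S) * T)))"
      if "x \<in> carrier G" "t \<in> {0..T}" for x t
      using that Suc q by (intro max_principle_step[OF der sub _ init]) (auto simp: M'_def)
    then show ?case by (simp add: q_def mult.assoc mult.left_commute mult.commute)
  qed
  have "(\<lambda>j. m + (M' - m) * q ^ j) \<longlonglongrightarrow> m + (M' - m) * 0"
    using q by (intro tendsto_intros LIMSEQ_power_zero) auto
  moreover have "\<forall>j. v x T \<le> m + (M' - m) * q ^ j"
    using * assms by simp
  ultimately show ?thesis
    by (metis (no_types, lifting) LIMSEQ_le_const add.right_neutral mult_zero_right)
qed


subsection \<open>Gradient bounds of Bernstein type\<close>

text \<open>This is the identity plus the adjacency operator. For nonnegative \<open>g\<close>, its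
  \<open>m\<close>-th power at \<open>x\<close> dominates every value of \<open>g\<close> within
  \<open>m\<close> steps of \<open>x\<close>.\<close>

definition spread :: "('a \<Rightarrow> real) \<Rightarrow> 'a \<Rightarrow> real"
  where "spread g x = g x + (\<Sum>s\<in>S. g (x \<otimes> s))"

lemma spread_pow_cong:
  assumes "\<And>y. y \<in> carrier G \<Longrightarrow> g y = h y" "x \<in> carrier G"
  shows "(spread ^^ m) g x = (spread ^^ m) h x"
  using assms(2) by (induction m arbitrary: x) (auto simp: assms(1) spread_def)

lemma spread_pow_add:
  "(spread ^^ m) (\<lambda>y. g y + h y) x = (spread ^^ m) g x + (spread ^^ m) h x"
  by (induction m arbitrary: x) (simp_all add: spread_def sum.distrib)

lemma spread_pow_nonneg:
  assumes "\<And>y. y \<in> carrier G \<Longrightarrow> g y \<ge> 0" "x \<in> carrier G"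
  shows "(spread ^^ m) g x \<ge> 0"
  using assms(2) by (induction m arbitrary: x) (auto simp: assms(1) spread_def intro!: sum_nonneg add_nonneg_nonneg)

lemma spread_pow_le:
  assumes "\<And>y. y \<in> carrier G \<Longrightarrow> g y \<le> B" "x \<in> carrier G"
  shows "(spread ^^ m) g x \<le> (real (card S) + 1) ^ m * B"
  using assms(2)
proof (induction m arbitrary: x)
  case (Suc m)
  let ?c = "(real (card S) + 1) ^ m * B"
  have "(spread ^^ Suc m) g x \<le> ?c + (\<Sum>s\<in>S. ?c)"
    using Suc by (simp add: spread_def del: sum_constant) (intro add_mono sum_mono Suc.IH; simp)
  then show ?case by (simp add: algebra_simps)
qed (simp add: assms(1))

lemma spread_pow_mono:
  assumes "\<And>y. y \<in> carrier G \<Longrightarrow> g y \<ge> 0" "x \<in> carrier G" "m \<le> n"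
  shows "(spread ^^ m) g x \<le> (spread ^^ n) g x"
  using assms(3)
proof (induction n rule: dec_induct)
  case (step n)
  have "(spread ^^ n) g x \<le> (spread ^^ Suc n) g x"
    using assms by (auto simp: spread_def intro!: sum_nonneg spread_pow_nonneg)
  with step show ?case by linarith
qed simp

lemma spread_pow_neighbour:
  assumes "\<And>y. y \<in> carrier G \<Longrightarrow> g y \<ge> 0" "x \<in> carrier G" "s \<in> S"
  shows "(spread ^^ m) g (x \<otimes> s) \<le> (spread ^^ Suc m) g x"
proof -
  have "(spread ^^ m) g (x \<otimes> s) \<le> (\<Sum>s\<in>S. (spread ^^ m) g (x \<otimes> s))"
    using assms fin_S by (intro member_le_sum) (auto intro!: spread_pow_nonneg)
  then show ?thesis
    using spread_pow_nonneg[of g x m] assms by (simp add: spread_def)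
qed

text \<open>Both operators are polynomials in the adjacency operator.\<close>

lemma lap_spread_pow:
  assumes "x \<in> carrier G"
  shows "lap ((spread ^^ m) g) x = (spread ^^ m) (lap g) x"
  using assms
proof (induction m arbitrary: x)
  case (Suc m)
  have *: "lap (spread h) x = spread (lap h) x" for h
    using Suc.prems by (simp add: lap_eq spread_def sum.distrib sum_subtractf algebra_simps flip: sum_distrib_left)
  show ?case using Suc.IH Suc.prems by (simp add: *) (simp add: spread_def[where x = x])
qed simp

lemma spread_pow_deriv:
  assumes "\<And>x. x \<in> carrier G \<Longrightarrow> (h x has_real_derivative h' x) F" "x \<in> carrier G"
  shows "((\<lambda>t. (spread ^^ m) (\<lambda>y. h y t) x) has_real_derivative (spread ^^ m) h' x) F"
  using assms(2) by (induction m arbitrary: x) (auto simp: assms(1) spread_def intro!: derivative_intros)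

text \<open>The displacement along \<open>s \<otimes> d\<close> splits at
  \<open>x \<otimes> s\<close>. The first part is bounded by a summand of \<open>gam g x\<close>;
  the second is a displacement by \<open>d\<close> seen from a neighbour, which one more
  \<open>spread\<close> absorbs.\<close>

lemma displacement_le_spread_gam:
  assumes "c \<in> carrier G"
  shows "\<exists>C\<ge>0. \<exists>m. \<forall>g. \<forall>x\<in>carrier G. (g (x \<otimes> c) - g x)\<^sup>2 \<le> C * (spread ^^ m) (gam g) x"
  using assms
proof (induction rule: word_induct_left)
  case one
  then show ?case by (auto intro!: exI[of _ 0])
next
  case (step s d)
  then obtain C m where C: "C \<ge> 0"
    and m: "\<And>g x. x \<in> carrier G \<Longrightarrow> (g (x \<otimes> d) - g x)\<^sup>2 \<le> C * (spread ^^ m) (gam g) x"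
    by blast
  have "(g (x \<otimes> (s \<otimes> d)) - g x)\<^sup>2 \<le> (2 * C + 2) * (spread ^^ Suc m) (gam g) x"
    if x: "x \<in> carrier G" for g x
  proof -
    let ?K = "(spread ^^ Suc m) (gam g) x"
    have "(g (x \<otimes> s \<otimes> d) - g (x \<otimes> s))\<^sup>2 \<le> C * ?K"
      using m[of "x \<otimes> s" g] mult_left_mono[OF spread_pow_neighbour[of "gam g" x s m] C] x step
      by (simp add: gam_nonneg)
    moreover have "(g (x \<otimes> s) - g x)\<^sup>2 \<le> ?K"
    proof -
      have "(g (x \<otimes> s) - g x)\<^sup>2 \<le> gam g x"
        using x step(1) fin_S by (subst gam_eq) (auto intro!: member_le_sum[of s S "\<lambda>s. (g (x \<otimes> s) - g x)\<^sup>2"])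
      also have "\<dots> \<le> ?K"
        using spread_pow_mono[of "gam g" x 0 "Suc m"] x by (simp add: gam_nonneg)
      finally show ?thesis .
    qed
    moreover have "(g (x \<otimes> s \<otimes> d) - g x)\<^sup>2
        \<le> 2 * (g (x \<otimes> s \<otimes> d) - g (x \<otimes> s))\<^sup>2 + 2 * (g (x \<otimes> s) - g x)\<^sup>2"
      using power2_add_le[of "g (x \<otimes> s \<otimes> d) - g (x \<otimes> s)" "g (x \<otimes> s) - g x"] by simp
    ultimately show ?thesis
      using x step by (simp add: m_assoc distrib_right)
  qed
  then show ?case using C by (intro exI[of _ "2 * C + 2"] conjI exI[of _ "Suc m"]) auto
qed

text \<open>Common constants are needed because the displacement will be a conjugate that varies
  with \<open>x\<close>.\<close>

lemma displacements_le_spread_gam: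
  assumes "finite A" "A \<subseteq> carrier G"
  shows "\<exists>C\<ge>0. \<exists>m. \<forall>c\<in>A. \<forall>g. \<forall>x\<in>carrier G.
    (g (x \<otimes> c) - g x)\<^sup>2 \<le> C * (spread ^^ m) (gam g) x"
  using assms
proof (induction rule: finite_induct)
  case (insert c A)
  then have "\<exists>C\<ge>0. \<exists>m. \<forall>d\<in>A. \<forall>g. \<forall>x\<in>carrier G.
      (g (x \<otimes> d) - g x)\<^sup>2 \<le> C * (spread ^^ m) (gam g) x"
    by simp
  then obtain C' m' where C': "C' \<ge> 0" "\<And>d g x. d \<in> A \<Longrightarrow> x \<in> carrier G \<Longrightarrow>
      (g (x \<otimes> d) - g x)\<^sup>2 \<le> C' * (spread ^^ m') (gam g) x"
    by blast
  obtain C m where C: "C \<ge> 0"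
    "\<And>g x. x \<in> carrier G \<Longrightarrow> (g (x \<otimes> c) - g x)\<^sup>2 \<le> C * (spread ^^ m) (gam g) x"
    using displacement_le_spread_gam[of c] insert.prems unfolding insert_subset by blast
  have le: "C * (spread ^^ m) (gam g) x \<le> (C + C') * (spread ^^ max m m') (gam g) x"
    "C' * (spread ^^ m') (gam g) x \<le> (C + C') * (spread ^^ max m m') (gam g) x"
    if "x \<in> carrier G" for g x
    using that C(1) C'(1) by (auto intro!: mult_mono spread_pow_mono spread_pow_nonneg gam_nonneg)
  have "(g (x \<otimes> d) - g x)\<^sup>2 \<le> (C + C') * (spread ^^ max m m') (gam g) x"
    if "d \<in> insert c A" "x \<in> carrier G" for d g x
    using that(1) order_trans[OF C(2) le(1)] order_trans[OF C'(2) le(2)] that(2) by blast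
  then show ?case
    using C(1) C'(1) by (intro exI[of _ "C + C'"] conjI exI[of _ "max m m'"]) simp_all
qed auto

section \<open>Decay estimates along the heat flow\<close>

definition bounded_sol :: "('a \<Rightarrow> real \<Rightarrow> real) \<Rightarrow> real \<Rightarrow> bool"
  where "bounded_sol f B \<longleftrightarrow> sol f \<and> (\<forall>x\<in>carrier G. \<forall>t\<ge>0. \<bar>f x t\<bar> \<le> B)"

text \<open>\<open>decays p F\<close> says that \<open>F\<close> is \<open>O(t powr (- p / 2))\<close> along the heat flow, uniformly in the point and
  in the solution relative to its supremum.\<close>

definition decays :: "nat \<Rightarrow> (('a \<Rightarrow> real) \<Rightarrow> 'a \<Rightarrow> real) \<Rightarrow> bool"
  where "decays p F \<longleftrightarrow> (\<exists>C\<ge>0. \<forall>f B x t. bounded_sol f B \<longrightarrow> x \<in> carrier G \<longrightarrow> t > 0 \<longrightarrow>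
    \<bar>F (\<lambda>y. f y t) x\<bar> \<le> C * B / sqrt t ^ p)"

definition preserves_sol :: "(('a \<Rightarrow> real) \<Rightarrow> 'a \<Rightarrow> real) \<Rightarrow> bool"
  where "preserves_sol F \<longleftrightarrow> (\<forall>f. sol f \<longrightarrow> sol (\<lambda>x t. F (\<lambda>y. f y t) x))"

text \<open>The maximum principle is applied to \<open>t (F f)\<^sup>2 + C (spread ^^ m) f\<^sup>2\<close>. Since \<open>spread\<close> commutes
  with the Laplacian, \<open>F\<close> may be controlled by the gradient at all points within distance \<open>m\<close>
  rather than at \<open>x\<close> alone.\<close>

lemma decays_energy:
  assumes pres: "preserves_sol F"
    and bnd: "\<And>g B x. (\<And>y. y \<in> carrier G \<Longrightarrow> \<bar>g y\<bar> \<le> B) \<Longrightarrow> x \<in> carrier G \<Longrightarrow> \<bar>F g x\<bar> \<le> c * B"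
    and C: "C \<ge> 0"
    and energy: "\<And>g x. x \<in> carrier G \<Longrightarrow> (F g x)\<^sup>2 \<le> C * (spread ^^ m) (gam g) x"
  shows "decays 1 F"
proof -
  define A where "A = C * (real (card S) + 1) ^ m"
  have A: "A \<ge> 0" using C by (simp add: A_def)
  have "\<bar>F (\<lambda>y. f y T) x\<bar> \<le> sqrt A * B / sqrt T ^ 1"
    if f: "sol f" and B: "\<And>x t. x \<in> carrier G \<Longrightarrow> t \<ge> 0 \<Longrightarrow> \<bar>f x t\<bar> \<le> B"
      and x: "x \<in> carrier G" and T: "T > 0" for f B x T
  proof -
    have B0: "B \<ge> 0" using B[OF x, of 0] by simp
    define \<phi> where "\<phi> = (\<lambda>x t. F (\<lambda>y. f y t) x)"
    have \<phi>: "sol \<phi>" using pres f by (simp add: preserves_sol_def \<phi>_def)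
    have \<phi>B: "\<bar>\<phi> x t\<bar> \<le> c * B" if "x \<in> carrier G" "t \<ge> 0" for x t
      using bnd[of "\<lambda>y. f y t" B x] B that by (simp add: \<phi>_def)
    define v where "v = (\<lambda>x t. t * (\<phi> x t)\<^sup>2 + C * (spread ^^ m) (\<lambda>y. (f y t)\<^sup>2) x)"
    define v' where "v' = (\<lambda>x t. (\<phi> x t)\<^sup>2 + t * (2 * \<phi> x t * lap (\<lambda>y. \<phi> y t) x)
      + C * (spread ^^ m) (\<lambda>y. 2 * f y t * lap (\<lambda>y. f y t) y) x)"
    have f2: "(spread ^^ m) (\<lambda>y. (f y t)\<^sup>2) x \<le> (real (card S) + 1) ^ m * B\<^sup>2"
      if "x \<in> carrier G" "t \<ge> 0" for x t
      using that B by (intro spread_pow_le) (metis B0 abs_le_square_iff abs_of_nonneg)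
    have "v x T \<le> A * B\<^sup>2"
    \<comment> \<open>\<open>M\<close> is only the a priori bound on \<open>[0, T]\<close> that the
      maximum principle requires. This is where \<open>c\<close> enters, and neither survives in the
      conclusion.\<close>
    proof (rule max_principle[where v = v and v' = v' and x = x and m = "A * B\<^sup>2" and M = "T * (c * B)\<^sup>2 + A * B\<^sup>2"])
      fix x t assume x: "x \<in> carrier G" and t: "(t::real) \<ge> 0"
      have "((\<lambda>t. (f y t)\<^sup>2) has_real_derivative 2 * f y t * lap (\<lambda>y. f y t) y) (at t within {0..})"
        if "y \<in> carrier G" for y
        using solD[OF f that t] by (auto intro!: derivative_eq_intros)
      from spread_pow_deriv[of "\<lambda>y t. (f y t)\<^sup>2", OF this x, of m] solD[OF \<phi> x t]
      show "(v x has_real_derivative v' x t) (at t within {0..})"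
        unfolding v_def v'_def by (auto intro!: derivative_eq_intros)
      have "lap (\<lambda>y. v y t) x = t * lap (\<lambda>y. (\<phi> y t)\<^sup>2) x + C * lap ((spread ^^ m) (\<lambda>y. (f y t)\<^sup>2)) x"
        using x by (simp add: v_def lap_eq sum_distrib_left algebra_simps flip: sum.distrib sum_subtractf)
      also have "lap ((spread ^^ m) (\<lambda>y. (f y t)\<^sup>2)) x
          = (spread ^^ m) (\<lambda>y. 2 * f y t * lap (\<lambda>y. f y t) y + gam (\<lambda>y. f y t) y) x"
        using x by (simp add: lap_spread_pow lap_power2 cong: spread_pow_cong)
      \<comment> \<open>For the square of a solution, the Laplacian exceeds the time derivative by
        \<open>gam\<close>. The gain from the squares of \<open>f\<close> pays for
        \<open>(\<phi> x t)\<^sup>2\<close>, which comes from differentiating the factor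
        \<open>t\<close>.\<close>
      finally have "lap (\<lambda>y. v y t) x - v' x t
          = t * gam (\<lambda>y. \<phi> y t) x + (C * (spread ^^ m) (gam (\<lambda>y. f y t)) x - (\<phi> x t)\<^sup>2)"
        using x by (simp add: lap_power2 spread_pow_add v'_def algebra_simps)
      also have "\<dots> \<ge> 0"
        using energy[OF x, of "\<lambda>y. f y t"] t gam_nonneg by (simp add: \<phi>_def)
      finally show "v' x t \<le> lap (\<lambda>y. v y t) x" by simp
    next
      fix x t assume "x \<in> carrier G" "0 \<le> t" "t \<le> T"
      moreover from this have "(\<phi> x t)\<^sup>2 \<le> (c * B)\<^sup>2"
        using \<phi>B[of x t] by (metis abs_ge_zero power2_abs power_mono)
      ultimately have "t * (\<phi> x t)\<^sup>2 \<le> T * (c * B)\<^sup>2"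
        "C * (spread ^^ m) (\<lambda>y. (f y t)\<^sup>2) x \<le> A * B\<^sup>2"
        using mult_left_mono[OF f2[of x t] C] by (auto intro!: mult_mono simp: A_def mult.assoc)
      then show "v x t \<le> T * (c * B)\<^sup>2 + A * B\<^sup>2"
        unfolding v_def by (rule add_mono)
    next
      fix x assume "x \<in> carrier G"
      then show "v x 0 \<le> A * B\<^sup>2"
        using mult_left_mono[OF f2[of x 0] C] by (simp add: v_def A_def mult.assoc)
    qed (use x T in auto)
    moreover have "(spread ^^ m) (\<lambda>y. (f y T)\<^sup>2) x \<ge> 0"
      using x by (intro spread_pow_nonneg) auto
    ultimately have "T * (\<phi> x T)\<^sup>2 \<le> A * B\<^sup>2"
      using C unfolding v_def by (smt (verit) mult_nonneg_nonneg)
    then have "(\<phi> x T)\<^sup>2 \<le> (sqrt A * B / sqrt T)\<^sup>2"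
      using A T by (simp add: power_divide power_mult_distrib field_simps)
    then have "\<bar>\<phi> x T\<bar> \<le> sqrt A * B / sqrt T"
      using A B0 T by (simp add: abs_le_square_iff[symmetric])
    then show ?thesis by (simp add: \<phi>_def)
  qed
  then show ?thesis
    unfolding decays_def bounded_sol_def using A by (intro exI[of _ "sqrt A"]) auto
qed

lemma decaysI:
  assumes "C \<ge> 0" "\<And>f B x t. bounded_sol f B \<Longrightarrow> x \<in> carrier G \<Longrightarrow> t > 0 \<Longrightarrow>
    \<bar>F (\<lambda>y. f y t) x\<bar> \<le> C * B / sqrt t ^ p"
  shows "decays p F"
  using assms unfolding decays_def by blast

lemma decays_mono:
  assumes "decays p H" "\<And>g x. x \<in> carrier G \<Longrightarrow> \<bar>F g x\<bar> \<le> \<bar>H g x\<bar>"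
  shows "decays p F"
proof -
  obtain C where C: "C \<ge> 0" "\<And>f B x t. bounded_sol f B \<Longrightarrow> x \<in> carrier G \<Longrightarrow> t > 0 \<Longrightarrow>
    \<bar>H (\<lambda>y. f y t) x\<bar> \<le> C * B / sqrt t ^ p"
    using assms(1) unfolding decays_def by blast
  show ?thesis by (rule decaysI[OF C(1)]) (blast intro: order_trans[OF assms(2) C(2)])
qed

lemma decays_abs: "decays p F \<Longrightarrow> decays p (\<lambda>g x. \<bar>F g x\<bar>)"
  by (rule decays_mono) auto

text \<open>The constant is uniform in the point, so the point may even depend on the function, as
  \<open>base g x\<close> will.\<close>

lemma decays_at:
  assumes "decays p F" "\<And>g x. x \<in> carrier G \<Longrightarrow> \<pi> g x \<in> carrier G"
  shows "decays p (\<lambda>g x. F g (\<pi> g x))"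
proof -
  obtain C where C: "C \<ge> 0" "\<And>f B x t. bounded_sol f B \<Longrightarrow> x \<in> carrier G \<Longrightarrow> t > 0 \<Longrightarrow>
    \<bar>F (\<lambda>y. f y t) x\<bar> \<le> C * B / sqrt t ^ p"
    using assms(1) unfolding decays_def by blast
  show ?thesis by (rule decaysI[OF C(1)]) (blast intro: C(2) assms(2))
qed

lemma decays_add:
  assumes "decays p F" "decays p H"
  shows "decays p (\<lambda>g x. F g x + H g x)"
proof -
  obtain C where C: "C \<ge> 0" "\<And>f B x t. bounded_sol f B \<Longrightarrow> x \<in> carrier G \<Longrightarrow> t > 0 \<Longrightarrow>
    \<bar>F (\<lambda>y. f y t) x\<bar> \<le> C * B / sqrt t ^ p"
    using assms(1) unfolding decays_def by blast
  obtain C' where C': "C' \<ge> 0" "\<And>f B x t. bounded_sol f B \<Longrightarrow> x \<in> carrier G \<Longrightarrow> t > 0 \<Longrightarrow>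
    \<bar>H (\<lambda>y. f y t) x\<bar> \<le> C' * B / sqrt t ^ p"
    using assms(2) unfolding decays_def by blast
  show ?thesis
  proof (rule decaysI)
    fix f B x and t :: real
    assume "bounded_sol f B" "x \<in> carrier G" "t > 0"
    from C(2)[OF this] C'(2)[OF this]
    have "\<bar>F (\<lambda>y. f y t) x\<bar> + \<bar>H (\<lambda>y. f y t) x\<bar> \<le> C * B / sqrt t ^ p + C' * B / sqrt t ^ p"
      by (rule add_mono)
    then show "\<bar>F (\<lambda>y. f y t) x + H (\<lambda>y. f y t) x\<bar> \<le> (C + C') * B / sqrt t ^ p"
      by (simp add: distrib_right add_divide_distrib)
  qed (use C(1) C'(1) in simp)
qed

lemma decays_zero: "decays p (\<lambda>g x. 0)"
  by (rule decaysI[of 0]) auto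

lemma decays_sum:
  assumes "\<And>i. i \<in> A \<Longrightarrow> decays p (F i)"
  shows "decays p (\<lambda>g x. \<Sum>i\<in>A. F i g x)"
  using assms by (induction A rule: infinite_finite_induct) (auto intro: decays_zero decays_add)

lemma decays_scale:
  assumes "decays p F"
  shows "decays p (\<lambda>g x. a * F g x)"
proof -
  obtain C where C: "C \<ge> 0" "\<And>f B x t. bounded_sol f B \<Longrightarrow> x \<in> carrier G \<Longrightarrow> t > 0 \<Longrightarrow>
    \<bar>F (\<lambda>y. f y t) x\<bar> \<le> C * B / sqrt t ^ p"
    using assms(1) unfolding decays_def by blast
  show ?thesis
  proof (rule decaysI)
    fix f B x and t :: real
    assume "bounded_sol f B" "x \<in> carrier G" "t > 0"
    from mult_left_mono[OF C(2)[OF this], of "\<bar>a\<bar>"]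
    show "\<bar>a * F (\<lambda>y. f y t) x\<bar> \<le> (\<bar>a\<bar> * C) * B / sqrt t ^ p"
      by (simp add: abs_mult mult.assoc)
  qed (use C(1) in simp)
qed

lemma sol_shift:
  assumes "sol f" "\<tau> \<ge> 0"
  shows "sol (\<lambda>x t. f x (t + \<tau>))"
  unfolding heat_solution_def
proof (intro ballI allI impI)
  fix x and t :: real
  assume *: "x \<in> carrier G" "t \<ge> 0"
  let ?d = "lap (\<lambda>y. f y (t + \<tau>)) x"
  have "(f x has_real_derivative ?d) (at (t + \<tau>) within (\<lambda>t. t + \<tau>) ` {0..})"
    using solD[OF assms(1), of x "t + \<tau>"] * assms(2) by (auto intro: DERIV_subset)
  moreover have "((\<lambda>t. t + \<tau>) has_real_derivative 1) (at t within {0..})"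
    by (auto intro!: derivative_eq_intros)
  ultimately show "((\<lambda>t. f x (t + \<tau>)) has_real_derivative ?d) (at t within {0..})"
    using DERIV_image_chain[of "f x" ?d "\<lambda>t. t + \<tau>" t "{0..}" 1] by (simp add: o_def)
qed

text \<open>By the semigroup property, two gradient-type bounds compose: run the inner one up to time
  \<open>t / 2\<close> and the outer one from there on.\<close>

lemma decays_comp:
  assumes F: "decays p F" and H: "decays q H" and pres: "preserves_sol H"
  shows "decays (p + q) (\<lambda>g. F (H g))"
proof -
  obtain C where C: "C \<ge> 0" "\<And>f B x t. bounded_sol f B \<Longrightarrow> x \<in> carrier G \<Longrightarrow> t > 0 \<Longrightarrow>
    \<bar>F (\<lambda>y. f y t) x\<bar> \<le> C * B / sqrt t ^ p"
    using F unfolding decays_def by blast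
  obtain C' where C': "C' \<ge> 0" "\<And>f B x t. bounded_sol f B \<Longrightarrow> x \<in> carrier G \<Longrightarrow> t > 0 \<Longrightarrow>
    \<bar>H (\<lambda>y. f y t) x\<bar> \<le> C' * B / sqrt t ^ q"
    using H unfolding decays_def by blast
  show ?thesis
  proof (rule decaysI)
    fix f B x and t :: real
    assume bs: "bounded_sol f B" and x: "x \<in> carrier G" and t: "t > 0"
    then have f: "sol f" and B: "\<And>x t. x \<in> carrier G \<Longrightarrow> t \<ge> 0 \<Longrightarrow> \<bar>f x t\<bar> \<le> B"
      by (auto simp: bounded_sol_def)
    have B0: "B \<ge> 0" using B[OF x, of 0] by simp
    define \<tau> where "\<tau> = t / 2"
    have \<tau>: "\<tau> > 0" "\<tau> + \<tau> = t" using t by (auto simp: \<tau>_def)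
    define h where "h = (\<lambda>x s. H (\<lambda>y. f y (s + \<tau>)) x)"
    have "sol h"
      using pres sol_shift[OF f, of \<tau>] \<tau> by (simp add: preserves_sol_def h_def)
    moreover have "\<bar>h y s\<bar> \<le> C' * B / sqrt \<tau> ^ q" if "y \<in> carrier G" "s \<ge> 0" for y s
    proof -
      have "\<bar>h y s\<bar> \<le> C' * B / sqrt (s + \<tau>) ^ q"
        unfolding h_def using that \<tau> by (intro C'(2) bs) auto
      also have "\<dots> \<le> C' * B / sqrt \<tau> ^ q"
        using that \<tau> C'(1) B0 by (intro divide_left_mono power_mono) auto
      finally show ?thesis .
    qed
    ultimately have "bounded_sol h (C' * B / sqrt \<tau> ^ q)"
      by (simp add: bounded_sol_def)
    then have "\<bar>F (\<lambda>y. h y \<tau>) x\<bar> \<le> C * (C' * B / sqrt \<tau> ^ q) / sqrt \<tau> ^ p"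
      using x \<tau> by (intro C(2)) auto
    also have "sqrt \<tau> = sqrt t / sqrt 2" by (simp add: \<tau>_def real_sqrt_divide)
    finally show "\<bar>F (H (\<lambda>y. f y t)) x\<bar> \<le> (C * C' * sqrt 2 ^ (p + q)) * B / sqrt t ^ (p + q)"
      using \<tau> by (simp add: h_def power_divide power_add field_simps)
  qed (use C(1) C'(1) in simp)
qed

section \<open>Left differences and the Laplacian to first order\<close>

definition ldiff :: "'a \<Rightarrow> ('a \<Rightarrow> real) \<Rightarrow> 'a \<Rightarrow> real"
  where "ldiff a g x = g (a \<otimes> x) - g x"

definition rdiff :: "'a \<Rightarrow> ('a \<Rightarrow> real) \<Rightarrow> 'a \<Rightarrow> real"
  where "rdiff a g x = g (x \<otimes> a) - g x"

text \<open>Edges are right multiplications, so left translation is a graph automorphism and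
  commutes with \<open>lap\<close>. Right differences need not preserve solutions.\<close>

lemma preserves_sol_ldiff:
  assumes "a \<in> carrier G"
  shows "preserves_sol (ldiff a)"
  unfolding preserves_sol_def heat_solution_def
proof (intro allI impI ballI)
  fix f x and t :: real
  assume f: "\<forall>x\<in>carrier G. \<forall>t\<ge>0. (f x has_real_derivative lap (\<lambda>y. f y t) x) (at t within {0..})"
    and xt: "x \<in> carrier G" "t \<ge> 0"
  have "lap (ldiff a (\<lambda>y. f y t)) x = lap (\<lambda>y. f y t) (a \<otimes> x) - lap (\<lambda>y. f y t) x"
    using assms xt by (simp add: lap_eq ldiff_def m_assoc sum_subtractf sum.distrib algebra_simps)
  then show "((\<lambda>t. ldiff a (\<lambda>y. f y t) x) has_real_derivative lap (\<lambda>y. ldiff a (\<lambda>y. f y t) y) x)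
      (at t within {0..})"
    unfolding ldiff_def using f xt assms by (auto intro!: derivative_eq_intros)
qed

lemma preserves_sol_lap: "preserves_sol lap"
  unfolding preserves_sol_def
proof (intro allI impI)
  fix f assume f: "sol f"
  show "sol (\<lambda>x t. lap (\<lambda>y. f y t) x)"
    unfolding heat_solution_def
  proof (intro allI impI ballI)
    fix x and t :: real
    assume xt: "x \<in> carrier G" "t \<ge> 0"
    have "((\<lambda>t. \<Sum>s\<in>S. f (x \<otimes> s) t - f x t) has_real_derivative
        (\<Sum>s\<in>S. lap (\<lambda>y. f y t) (x \<otimes> s) - lap (\<lambda>y. f y t) x)) (at t within {0..})"
      using solD[OF f] xt by (intro derivative_intros) auto
    then show "((\<lambda>t. lap (\<lambda>y. f y t) x) has_real_derivative lap (lap (\<lambda>y. f y t)) x) (at t within {0..})"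
      using xt by (simp add: lap_eq)
  qed
qed

text \<open>Cauchy-Schwarz bounds \<open>(lap g x)\<^sup>2\<close> by
  \<open>card S * gam g x\<close>, an energy bound with no spreading. This rate is an input for the
  sharper \<open>decays_lap\<close>.\<close>

lemma decays_lap_1: "decays 1 lap"
proof (rule decays_energy[OF preserves_sol_lap, where c = "2 * real (card S)" and C = "real (card S)" and m = 0])
  fix g :: "'a \<Rightarrow> real" and B x assume B: "\<And>y. y \<in> carrier G \<Longrightarrow> \<bar>g y\<bar> \<le> B" and x: "x \<in> carrier G"
  have "\<bar>g (x \<otimes> s) - g x\<bar> \<le> 2 * B" if "s \<in> S" for s
    using B[of x] B[of "x \<otimes> s"] x that by auto
  then have "(\<Sum>s\<in>S. \<bar>g (x \<otimes> s) - g x\<bar>) \<le> real (card S) * (2 * B)"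
    by (intro sum_bounded_above)
  then show "\<bar>lap g x\<bar> \<le> 2 * real (card S) * B"
    using order_trans[OF sum_abs[of "\<lambda>s. g (x \<otimes> s) - g x" S]] x by (simp add: lap_eq mult_ac)
next
  fix g :: "'a \<Rightarrow> real" and x assume x: "x \<in> carrier G"
  have "(\<Sum>s\<in>S. (g (x \<otimes> s) - g x) * 1)\<^sup>2 \<le> (\<Sum>s\<in>S. (g (x \<otimes> s) - g x)\<^sup>2) * (\<Sum>s\<in>S. 1\<^sup>2)"
    by (rule Cauchy_Schwarz_ineq_sum)
  then show "(lap g x)\<^sup>2 \<le> real (card S) * (spread ^^ 0) (gam g) x"
    using x by (simp add: lap_eq gam_eq mult.commute)
qed simp

text \<open>Since \<open>a \<otimes> x = x \<otimes> (inv x \<otimes> a \<otimes> x)\<close>, a left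
  difference is a right displacement by a conjugate of \<open>a\<close>. Having finitely many
  conjugates makes the energy bound uniform in \<open>x\<close>.\<close>

lemma decays_ldiff_conj:
  assumes a: "a \<in> carrier G" and fin: "finite ((\<lambda>x. inv x \<otimes> a \<otimes> x) ` carrier G)"
  shows "decays 1 (ldiff a)"
proof -
  let ?A = "(\<lambda>x. inv x \<otimes> a \<otimes> x) ` carrier G"
  have "?A \<subseteq> carrier G" using a by auto
  from displacements_le_spread_gam[OF fin this] obtain C m where "C \<ge> 0"
    and C: "\<And>c g x. c \<in> ?A \<Longrightarrow> x \<in> carrier G \<Longrightarrow> (g (x \<otimes> c) - g x)\<^sup>2 \<le> C * (spread ^^ m) (gam g) x"
    by blast
  show ?thesis
  proof (rule decays_energy[OF preserves_sol_ldiff[OF a] _ \<open>C \<ge> 0\<close>, where c = 2 and m = m])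
    fix g :: "'a \<Rightarrow> real" and B x assume B: "\<And>y. y \<in> carrier G \<Longrightarrow> \<bar>g y\<bar> \<le> B" and x: "x \<in> carrier G"
    have "\<bar>g x\<bar> \<le> B" "\<bar>g (a \<otimes> x)\<bar> \<le> B"
      using a x by (auto intro: B)
    then show "\<bar>ldiff a g x\<bar> \<le> 2 * B"
      unfolding ldiff_def by linarith
  next
    fix g :: "'a \<Rightarrow> real" and x assume x: "x \<in> carrier G"
    have "x \<otimes> (inv x \<otimes> a \<otimes> x) = a \<otimes> x"
      using a x by (simp flip: m_assoc)
    then show "(ldiff a g x)\<^sup>2 \<le> C * (spread ^^ m) (gam g) x"
      using C[of "inv x \<otimes> a \<otimes> x" x g] x by (simp add: ldiff_def)
  qed
qed

end

section \<open>Groups with a normal abelian subgroup of finite index\<close>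

locale virtually_abelian_heat = cayley_heat G S for G (structure) and S +
  fixes N :: "'a set" and rep :: "'a \<Rightarrow> 'a"
  assumes N_normal: "N \<lhd> G"
    and N_comm: "\<And>m n. m \<in> N \<Longrightarrow> n \<in> N \<Longrightarrow> m \<otimes> n = n \<otimes> m"
    and finite_reps: "finite (rep ` carrier G)"
    and rep_closed [simp]: "\<And>x. x \<in> carrier G \<Longrightarrow> rep x \<in> carrier G"
    and rep_N: "\<And>x. x \<in> carrier G \<Longrightarrow> x \<otimes> inv (rep x) \<in> N"
    and rep_mult: "\<And>n x. n \<in> N \<Longrightarrow> x \<in> carrier G \<Longrightarrow> rep (n \<otimes> x) = rep x"
begin

text \<open>A transversal of the cosets of \<open>N\<close>; its finiteness expresses the finite
  index.\<close>

abbreviation R :: "'a set"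
  where "R \<equiv> rep ` carrier G"

lemma N_carrier [simp]: "n \<in> N \<Longrightarrow> n \<in> carrier G"
  by (rule subgroup.mem_carrier[OF normal_imp_subgroup[OF N_normal]])

lemma inv_N: "n \<in> N \<Longrightarrow> inv n \<in> N"
  by (rule subgroup.m_inv_closed[OF normal_imp_subgroup[OF N_normal]])

lemma R_carrier [simp]: "r \<in> R \<Longrightarrow> r \<in> carrier G"
  by auto

lemma rep_decomp: "x \<in> carrier G \<Longrightarrow> x \<otimes> inv (rep x) \<otimes> rep x = x"
  by (simp add: m_assoc)

lemma rep_R: "r \<in> R \<Longrightarrow> rep r = r"
proof -
  assume "r \<in> R"
  then obtain x where x: "x \<in> carrier G" "r = rep x" by blast
  then show "rep r = r"
    using rep_mult[OF rep_N[OF x(1)], of "rep x"] rep_decomp[OF x(1)] by simp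
qed

text \<open>In \<open>x = m \<otimes> rep x\<close> the factor \<open>m \<in> N\<close> commutes
  with \<open>n\<close>, so the conjugate depends only on \<open>rep x\<close>.\<close>

lemma finite_conjugates:
  assumes "n \<in> N"
  shows "finite ((\<lambda>x. inv x \<otimes> n \<otimes> x) ` carrier G)"
proof (rule finite_surj[OF finite_reps])
  have *: "inv x \<otimes> n \<otimes> x = inv (rep x) \<otimes> n \<otimes> rep x" if x: "x \<in> carrier G" for x
  proof -
    define m where "m = x \<otimes> inv (rep x)"
    have m: "m \<in> N" unfolding m_def by (rule rep_N[OF x])
    have x_eq: "m \<otimes> rep x = x" unfolding m_def by (rule rep_decomp[OF x])
    have "inv (m \<otimes> rep x) \<otimes> n \<otimes> (m \<otimes> rep x) = inv (rep x) \<otimes> (inv m \<otimes> (n \<otimes> m)) \<otimes> rep x"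
      using m assms x by (simp add: inv_mult_group m_assoc)
    also have "inv m \<otimes> (n \<otimes> m) = n"
      using m assms by (simp add: N_comm[of n m] flip: m_assoc)
    finally show ?thesis by (simp only: x_eq)
  qed
  show "(\<lambda>x. inv x \<otimes> n \<otimes> x) ` carrier G \<subseteq> (\<lambda>r. inv r \<otimes> n \<otimes> r) ` R"
    by (rule image_subsetI, subst *) (assumption | intro imageI)+
qed

lemma decays_ldiff: "n \<in> N \<Longrightarrow> decays 1 (ldiff n)"
  by (rule decays_ldiff_conj) (auto intro: finite_conjugates)

text \<open>The identity \<open>x \<otimes> n = (x \<otimes> n \<otimes> inv x) \<otimes> x\<close>
  turns the right difference into a left one by a conjugate depending on \<open>x\<close>. Summing
  over the finite conjugacy class removes this dependence.\<close>

lemma decays_rdiff_N: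
  assumes n: "n \<in> N"
  shows "decays 1 (rdiff n)"
proof (rule decays_mono)
  let ?A = "(\<lambda>x. inv x \<otimes> n \<otimes> x) ` carrier G"
  show "decays 1 (\<lambda>g x. \<Sum>m\<in>?A. \<bar>ldiff m g x\<bar>)"
  proof (intro decays_sum decays_abs decays_ldiff)
    show "m \<in> N" if "m \<in> ?A" for m
      using that n N_normal by (auto intro: normal.inv_op_closed1)
  qed
  fix g x assume x: "x \<in> carrier G"
  have "x \<otimes> n = x \<otimes> n \<otimes> inv x \<otimes> x"
    using x n by (simp add: m_assoc)
  then have "\<bar>rdiff n g x\<bar> = \<bar>ldiff (x \<otimes> n \<otimes> inv x) g x\<bar>"
    by (simp add: rdiff_def ldiff_def)
  also have "\<dots> \<le> (\<Sum>m\<in>?A. \<bar>ldiff m g x\<bar>)"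
    using x n finite_conjugates[OF n]
    by (intro member_le_sum) (auto intro!: image_eqI[of _ _ "inv x"])
  finally show "\<bar>rdiff n g x\<bar> \<le> \<bar>\<Sum>m\<in>?A. \<bar>ldiff m g x\<bar>\<bar>"
    by simp
qed


subsection \<open>Differences across cosets\<close>

text \<open>On the coset of \<open>x\<close> the function is minimised over the finitely many representatives.
  Up to an error of order \<open>1 / sqrt t\<close> this point is a minimum over the whole group, and since
  the Laplacian is of the same order, so is the growth along each further generator.\<close>

definition base :: "('a \<Rightarrow> real) \<Rightarrow> 'a \<Rightarrow> 'a"
  where "base g x = x \<otimes> arg_min_on (\<lambda>r. g (x \<otimes> r)) R"

lemma base_rep:
  assumes "x \<in> carrier G"
  obtains r where "r \<in> R" "base g x = x \<otimes> r" "\<And>r'. r' \<in> R \<Longrightarrow> g (x \<otimes> r) \<le> g (x \<otimes> r')"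
proof
  have "R \<noteq> {}" using assms by auto
  from arg_min_if_finite[OF finite_reps this, of "\<lambda>r. g (x \<otimes> r)"]
  show "arg_min_on (\<lambda>r. g (x \<otimes> r)) R \<in> R"
    "\<And>r'. r' \<in> R \<Longrightarrow> g (x \<otimes> arg_min_on (\<lambda>r. g (x \<otimes> r)) R) \<le> g (x \<otimes> r')"
    by (auto simp: not_less)
qed (simp add: base_def)

lemma base_closed [simp]:
  assumes "x \<in> carrier G"
  shows "base g x \<in> carrier G"
proof -
  obtain r where "r \<in> R" "base g x = x \<otimes> r" using base_rep[OF assms] by blast
  then show ?thesis using assms by auto
qed

text \<open>Moving by \<open>v\<close> from the minimiser \<open>x \<otimes> r\<close> leads, up to
  an element of \<open>N\<close> on the right, to \<open>x \<otimes> rep (r \<otimes> v)\<close>,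
  where \<open>g\<close> is no smaller. The drop is thus at most a difference along
  \<open>N\<close>.\<close>

lemma decays_below_base:
  assumes v: "v \<in> carrier G"
  shows "decays 1 (\<lambda>g x. max 0 (g (base g x) - g (base g x \<otimes> v)))"
proof (rule decays_mono)
  \<comment> \<open>\<open>c r\<close> solves
    \<open>rep (r \<otimes> v) \<otimes> c r = r \<otimes> v\<close>; it is a conjugate of the
    element given by \<open>rep_N\<close>, hence in \<open>N\<close> by normality.\<close>
  define c where "c = (\<lambda>r. inv (rep (r \<otimes> v)) \<otimes> (r \<otimes> v))"
  have c: "c r \<in> N" if r: "r \<in> R" for r
  proof -
    have "c r = inv (rep (r \<otimes> v)) \<otimes> (r \<otimes> v \<otimes> inv (rep (r \<otimes> v))) \<otimes> rep (r \<otimes> v)"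
      using r v by (simp add: c_def m_assoc)
    then show ?thesis
      using r v by (auto intro!: normal.inv_op_closed1[OF N_normal] rep_N)
  qed
  show "decays 1 (\<lambda>g x. \<Sum>r\<in>R. \<bar>rdiff (c r) g (x \<otimes> rep (r \<otimes> v))\<bar>)"
  proof (rule decays_sum)
    fix r assume r: "r \<in> R"
    show "decays 1 (\<lambda>g x. \<bar>rdiff (c r) g (x \<otimes> rep (r \<otimes> v))\<bar>)"
      using r v c by (intro decays_abs decays_at[of 1 "rdiff (c r)" "\<lambda>g x. x \<otimes> rep (r \<otimes> v)"] decays_rdiff_N) auto
  qed
  fix g x assume x: "x \<in> carrier G"
  obtain r where r: "r \<in> R" "base g x = x \<otimes> r"
    and min: "\<And>r'. r' \<in> R \<Longrightarrow> g (x \<otimes> r) \<le> g (x \<otimes> r')"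
    using base_rep[OF x, of g] by blast
  have rc: "rep (r \<otimes> v) \<otimes> c r = r \<otimes> v"
    using r v by (simp add: c_def flip: m_assoc)
  have cl: "c r \<in> carrier G" "r \<in> carrier G" using c r by auto
  have "g (x \<otimes> r) - g (x \<otimes> r \<otimes> v) \<le> g (x \<otimes> rep (r \<otimes> v)) - g (x \<otimes> rep (r \<otimes> v) \<otimes> c r)"
    using min[of "rep (r \<otimes> v)"] cl v x rc by (simp add: m_assoc)
  also have "\<dots> \<le> \<bar>rdiff (c r) g (x \<otimes> rep (r \<otimes> v))\<bar>"
    by (simp add: rdiff_def)
  also have "\<dots> \<le> (\<Sum>r\<in>R. \<bar>rdiff (c r) g (x \<otimes> rep (r \<otimes> v))\<bar>)"
    using r finite_reps by (intro member_le_sum) auto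
  finally show "\<bar>max 0 (g (base g x) - g (base g x \<otimes> v))\<bar>
      \<le> \<bar>\<Sum>r\<in>R. \<bar>rdiff (c r) g (x \<otimes> rep (r \<otimes> v))\<bar>\<bar>"
    by (auto simp: r(2) sum_nonneg)
qed

text \<open>All neighbours of \<open>base g x \<otimes> v\<close> lie nearly above the base value,
  and their total excess is controlled by the Laplacian and the induction hypothesis. So no single
  excess can be large.\<close>

lemma decays_above_base:
  assumes "v \<in> carrier G"
  shows "decays 1 (\<lambda>g x. max 0 (g (base g x \<otimes> v) - g (base g x)))"
  using assms
proof (induction rule: word_induct_right)
  case one
  show ?case by (rule decays_mono[OF decays_zero]) simp
next
  case (step s v)
  define below where "below = (\<lambda>s g x. max 0 (g (base g x) - g (base g x \<otimes> (v \<otimes> s))))"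
  define H where "H = (\<lambda>g x. \<bar>lap g (base g x \<otimes> v)\<bar>
    + real (card S) * max 0 (g (base g x \<otimes> v) - g (base g x)) + (\<Sum>s\<in>S. below s g x))"
  show ?case
  proof (rule decays_mono)
    show "decays 1 H"
      unfolding H_def
    proof (intro decays_add)
      show "decays 1 (\<lambda>g x. \<bar>lap g (base g x \<otimes> v)\<bar>)"
        using step by (intro decays_abs decays_at[OF decays_lap_1]) auto
      show "decays 1 (\<lambda>g x. real (card S) * max 0 (g (base g x \<otimes> v) - g (base g x)))"
        by (rule decays_scale[OF step.IH])
      show "decays 1 (\<lambda>g x. \<Sum>s\<in>S. below s g x)"
        unfolding below_def using step by (intro decays_sum decays_below_base) auto
    qed
    fix g x assume x: "x \<in> carrier G"
    let ?b = "base g x"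
    \<comment> \<open>Each \<open>?e s\<close> is the positive part of the rise from the base to
      \<open>v \<otimes> s\<close>, telescoped so that the sum over \<open>S\<close> exposes
      \<open>lap\<close>.\<close>
    let ?e = "\<lambda>s. (g (?b \<otimes> v \<otimes> s) - g (?b \<otimes> v)) + (g (?b \<otimes> v) - g ?b) + below s g x"
    have b: "?b \<in> carrier G" using x by simp
    have e: "?e s' \<ge> 0" "below s' g x \<ge> 0" if "s' \<in> S" for s'
      using that b step by (simp_all add: below_def m_assoc)
    have "g (?b \<otimes> (v \<otimes> s)) - g ?b \<le> ?e s"
      using step b e(2)[of s] by (simp add: m_assoc)
    also have "\<dots> \<le> sum ?e S"
      using step fin_S e by (intro member_le_sum) auto
    also have "\<dots> = lap g (?b \<otimes> v) + real (card S) * (g (?b \<otimes> v) - g ?b) + (\<Sum>s\<in>S. below s g x)"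
      using b step by (simp only: sum.distrib sum_constant lap_eq m_closed)
    also have "\<dots> \<le> H g x"
      unfolding H_def by (intro add_mono mult_left_mono) auto
    finally have "g (?b \<otimes> (v \<otimes> s)) - g ?b \<le> H g x" .
    moreover have "H g x \<ge> 0"
      unfolding H_def by (auto intro!: add_nonneg_nonneg sum_nonneg simp: below_def)
    ultimately show "\<bar>max 0 (g (?b \<otimes> (v \<otimes> s)) - g ?b)\<bar> \<le> \<bar>H g x\<bar>"
      by simp
  qed
qed

text \<open>Both \<open>x\<close> and \<open>x \<otimes> a\<close> are right translates of
  \<open>base g x = x \<otimes> r\<close>, by \<open>inv r\<close> and
  \<open>inv r \<otimes> a\<close>. As \<open>r\<close> depends on \<open>g\<close> and
  \<open>x\<close>, the bound sums over \<open>R\<close>.\<close>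

lemma decays_rdiff:
  assumes a: "a \<in> carrier G"
  shows "decays 1 (rdiff a)"
proof (rule decays_mono)
  define dev where "dev = (\<lambda>v g x. max 0 (g (base g x) - g (base g x \<otimes> v))
    + max 0 (g (base g x \<otimes> v) - g (base g x)))"
  have dev: "dev v g x = \<bar>g (base g x \<otimes> v) - g (base g x)\<bar>" for v g x
    by (simp add: dev_def)
  show "decays 1 (\<lambda>g x. \<Sum>r\<in>R. dev (inv r \<otimes> a) g x + dev (inv r) g x)"
    unfolding dev_def using a
    by (intro decays_sum decays_add decays_below_base decays_above_base) auto
  fix g x assume x: "x \<in> carrier G"
  obtain r where r: "r \<in> R" "base g x = x \<otimes> r" "\<And>r'. r' \<in> R \<Longrightarrow> g (x \<otimes> r) \<le> g (x \<otimes> r')"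
    using base_rep[OF x, of g] by blast
  have rc: "r \<in> carrier G" using r(1) by simp
  have x_eq: "base g x \<otimes> inv r = x"
    using x rc by (simp add: r(2) m_assoc)
  have "base g x \<otimes> (inv r \<otimes> a) = x \<otimes> a"
    using a x rc by (simp add: x_eq flip: m_assoc)
  then have "\<bar>rdiff a g x\<bar> \<le> dev (inv r \<otimes> a) g x + dev (inv r) g x"
    by (simp add: rdiff_def dev x_eq)
  also have "\<dots> \<le> (\<Sum>r\<in>R. dev (inv r \<otimes> a) g x + dev (inv r) g x)"
    by (rule member_le_sum[OF r(1) _ finite_reps]) (simp add: dev)
  finally show "\<bar>rdiff a g x\<bar> \<le> \<bar>\<Sum>r\<in>R. dev (inv r \<otimes> a) g x + dev (inv r) g x\<bar>"
    by simp
qed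


subsection \<open>The time derivative\<close>

text \<open>Pairs in \<open>R \<times> S\<close> are the directed edges of the quotient graph by
  left translations from \<open>N\<close>; this map reverses an edge.\<close>

definition step_rep :: "'a \<times> 'a \<Rightarrow> 'a \<times> 'a"
  where "step_rep p = (rep (fst p \<otimes> snd p), inv (snd p))"

text \<open>The voltage of such an edge: \<open>r \<otimes> s = step_shift (r, s) \<otimes> rep (r
  \<otimes> s)\<close>.\<close>

definition step_shift :: "'a \<times> 'a \<Rightarrow> 'a"
  where "step_shift p = fst p \<otimes> snd p \<otimes> inv (rep (fst p \<otimes> snd p))"

text \<open>Everything rests on \<open>rep (r \<otimes> s) \<otimes> inv s = inv (step_shift p)
  \<otimes> r\<close>: walking back along the edge undoes the shift.\<close>

lemma step_rep_invol:
  assumes "p \<in> R \<times> S"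
  shows "step_rep p \<in> R \<times> S" "step_rep (step_rep p) = p"
    "step_shift p \<in> N" "step_shift (step_rep p) = inv (step_shift p)"
proof -
  obtain r s where p: "p = (r, s)" "r \<in> R" "s \<in> S" using assms by auto
  have c: "r \<in> carrier G" "s \<in> carrier G" using p by auto
  show "step_rep p \<in> R \<times> S"
    using p c S_inv by (auto simp: step_rep_def)
  show n: "step_shift p \<in> N"
    using p c by (auto simp: step_shift_def intro: rep_N)
  have eq1: "rep (r \<otimes> s) \<otimes> inv s = inv (step_shift p) \<otimes> r"
    using p c by (simp add: step_shift_def inv_mult_group m_assoc)
  have eq2: "rep (rep (r \<otimes> s) \<otimes> inv s) = r"
    unfolding eq1 using rep_mult[OF inv_N[OF n] c(1)] rep_R[OF p(2)] by (rule trans)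
  show "step_rep (step_rep p) = p"
    using c by (simp add: p step_rep_def eq2)
  have "step_shift (step_rep p) = rep (r \<otimes> s) \<otimes> inv s \<otimes> inv r"
    by (simp add: p step_rep_def step_shift_def eq2)
  also have "\<dots> = inv (step_shift p) \<otimes> r \<otimes> inv r"
    by (simp only: eq1)
  also have "\<dots> = inv (step_shift p)"
    using n c by (simp add: m_assoc)
  finally show "step_shift (step_rep p) = inv (step_shift p)" .
qed

lemma sum_step_rep: "(\<Sum>p\<in>R \<times> S. h (step_rep p)) = (\<Sum>p\<in>R \<times> S. h p)"
  by (rule sum.reindex_bij_witness[of _ step_rep step_rep]) (use step_rep_invol in auto)

text \<open>The first-order terms of the Laplacian cancel in the sum over a transversal, because the
  shifts by elements of \<open>N\<close> occur in inverse pairs.\<close>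

lemma sum_lap_reps:
  assumes n: "n \<in> N"
  shows "(\<Sum>r\<in>R. lap g (n \<otimes> r)) =
    (\<Sum>p\<in>R \<times> S. rdiff (rep (fst p \<otimes> snd p)) (ldiff (step_shift p) g) n
      + (- 1 / 2) * ldiff (step_shift p) (ldiff (inv (step_shift p)) g) n)"
proof -
  let ?a = step_shift and ?r = "\<lambda>p. rep (fst p \<otimes> snd p)"
  have "(\<Sum>r\<in>R. lap g (n \<otimes> r)) = (\<Sum>r\<in>R. \<Sum>s\<in>S. g (n \<otimes> r \<otimes> s) - g (n \<otimes> r))"
    using n by (intro sum.cong) (auto simp: lap_eq)
  also have "\<dots> = (\<Sum>p\<in>R \<times> S. g (n \<otimes> fst p \<otimes> snd p)) - (\<Sum>p\<in>R \<times> S. g (n \<otimes> fst p))"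
    by (simp only: sum.cartesian_product split_def sum_subtractf)
  \<comment> \<open>Edge reversal replaces initial representatives by terminal ones, so that matched
    points differ by a shift from \<open>N\<close>.\<close>
  also have "(\<Sum>p\<in>R \<times> S. g (n \<otimes> fst p)) = (\<Sum>p\<in>R \<times> S. g (n \<otimes> ?r p))"
    using sum_step_rep[of "\<lambda>p. g (n \<otimes> fst p)"] by (simp add: step_rep_def)
  also have "(\<Sum>p\<in>R \<times> S. g (n \<otimes> fst p \<otimes> snd p)) - \<dots> = (\<Sum>p\<in>R \<times> S. ldiff (?a p) g (n \<otimes> ?r p))"
    unfolding sum_subtractf[symmetric]
  proof (rule sum.cong[OF refl])
    fix p assume p: "p \<in> R \<times> S"
    then have c: "fst p \<in> carrier G" "snd p \<in> carrier G" by auto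
    have "?a p \<in> N" using step_rep_invol(3)[OF p] .
    \<comment> \<open>Commutativity of \<open>N\<close> brings the shift to the left of
      \<open>n\<close>, where it acts as \<open>ldiff\<close>.\<close>
    then have "?a p \<otimes> (n \<otimes> ?r p) = n \<otimes> (?a p \<otimes> ?r p)"
      using n c N_comm[of "?a p" n] by (simp flip: m_assoc)
    also have "?a p \<otimes> ?r p = fst p \<otimes> snd p"
      unfolding step_shift_def using c by (intro rep_decomp) simp
    finally show "g (n \<otimes> fst p \<otimes> snd p) - g (n \<otimes> ?r p) = ldiff (?a p) g (n \<otimes> ?r p)"
      using n c by (simp add: ldiff_def m_assoc)
  qed
  also have "\<dots> = (\<Sum>p\<in>R \<times> S. rdiff (?r p) (ldiff (?a p) g) n) + (\<Sum>p\<in>R \<times> S. ldiff (?a p) g n)"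
    by (simp add: rdiff_def flip: sum.distrib)
  \<comment> \<open>Averaging each edge with its reverse leaves second differences, since
    \<open>ldiff a g n + ldiff (inv a) g n = - ldiff a (ldiff (inv a) g) n\<close>.\<close>
  also have "(\<Sum>p\<in>R \<times> S. ldiff (?a p) g n)
      = (\<Sum>p\<in>R \<times> S. (- 1 / 2) * ldiff (?a p) (ldiff (inv (?a p)) g) n)"
  proof -
    have "(\<Sum>p\<in>R \<times> S. ldiff (inv (?a p)) g n) = (\<Sum>p\<in>R \<times> S. ldiff (?a p) g n)"
      by (subst sum_step_rep[symmetric]) (simp add: step_rep_invol(4))
    then have "(\<Sum>p\<in>R \<times> S. ldiff (?a p) g n)
        = (\<Sum>p\<in>R \<times> S. (1 / 2) * (ldiff (?a p) g n + ldiff (inv (?a p)) g n))"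
      by (simp add: sum.distrib flip: sum_distrib_left sum_divide_distrib)
    also have "\<dots> = (\<Sum>p\<in>R \<times> S. (- 1 / 2) * ldiff (?a p) (ldiff (inv (?a p)) g) n)"
    proof (rule sum.cong[OF refl])
      fix p assume "p \<in> R \<times> S"
      then have "?a p \<in> carrier G" using step_rep_invol(3) by simp
      then have "inv (?a p) \<otimes> (?a p \<otimes> n) = n"
        using n by (simp flip: m_assoc)
      then show "(1 / 2) * (ldiff (?a p) g n + ldiff (inv (?a p)) g n)
          = (- 1 / 2) * ldiff (?a p) (ldiff (inv (?a p)) g) n"
        by (simp add: ldiff_def field_simps)
    qed
    finally show ?thesis .
  qed
  finally show ?thesis by (simp only: sum.distrib)
qed

text \<open>Up to right differences of \<open>lap g\<close>, \<open>card R\<close> times the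
  Laplacian at \<open>x\<close> is its sum over the points \<open>\<nu> x \<otimes> r\<close>. That
  sum is second order by \<open>sum_lap_reps\<close>; each difference composes two first-order
  bounds.\<close>

lemma decays_lap: "decays 2 lap"
proof (rule decays_mono)
  define \<nu> where "\<nu> = (\<lambda>x. x \<otimes> inv (rep x))"
  have \<nu>: "\<nu> x \<in> N" "\<nu> x \<in> carrier G" if "x \<in> carrier G" for x
    using that rep_N by (auto simp: \<nu>_def)
  define F where "F = (\<lambda>g n. \<Sum>p\<in>R \<times> S. rdiff (rep (fst p \<otimes> snd p)) (ldiff (step_shift p) g) n
      + (- 1 / 2) * ldiff (step_shift p) (ldiff (inv (step_shift p)) g) n)"
  \<comment> \<open>The sum over \<open>r\<close> covers all possible values of
    \<open>rep x\<close>.\<close>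
  define E where "E = (\<lambda>g x. \<Sum>r\<in>R. \<Sum>r'\<in>R. \<bar>rdiff (inv r \<otimes> r') (lap g) (\<nu> x \<otimes> r)\<bar>)"
  have "decays (1 + 1) F"
    unfolding F_def
  proof (intro decays_sum decays_add)
    fix p assume p: "p \<in> R \<times> S"
    let ?a = "step_shift p"
    have a: "?a \<in> N" "inv ?a \<in> N" using step_rep_invol(3)[OF p] inv_N by auto
    have "rep (fst p \<otimes> snd p) \<in> carrier G" using p by auto
    \<comment> \<open>Only the inner operator must preserve solutions, so the right difference goes
      outside.\<close>
    then show "decays (1 + 1) (\<lambda>g. rdiff (rep (fst p \<otimes> snd p)) (ldiff ?a g))"
      using a by (intro decays_comp[OF decays_rdiff decays_ldiff preserves_sol_ldiff]) simp_all
    show "decays (1 + 1) (\<lambda>g n. (- 1 / 2) * ldiff ?a (ldiff (inv ?a) g) n)"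
      using a by (intro decays_scale decays_comp[OF decays_ldiff decays_ldiff preserves_sol_ldiff]) simp_all
  qed
  then have F: "decays (1 + 1) (\<lambda>g x. F g (\<nu> x))"
    using \<nu>(2) by (rule decays_at)
  have E: "decays (1 + 1) E"
    unfolding E_def
  proof (intro decays_sum decays_abs)
    fix r r' assume r: "r \<in> R" "r' \<in> R"
    then have "decays (1 + 1) (\<lambda>g. rdiff (inv r \<otimes> r') (lap g))"
      by (intro decays_comp[OF decays_rdiff decays_lap_1 preserves_sol_lap]) auto
    then show "decays (1 + 1) (\<lambda>g x. rdiff (inv r \<otimes> r') (lap g) (\<nu> x \<otimes> r))"
      by (rule decays_at) (use r \<nu>(2) in simp)
  qed
  show "decays 2 (\<lambda>g x. \<bar>F g (\<nu> x)\<bar> + E g x)"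
    using decays_add[OF decays_abs[OF F] E] by (simp only: one_add_one)
  fix g x assume x: "x \<in> carrier G"
  let ?r = "rep x"
  have r: "?r \<in> R" using x by simp
  have x_eq: "\<nu> x \<otimes> ?r = x" using x rep_decomp by (simp add: \<nu>_def)
  have "\<bar>\<Sum>r'\<in>R. rdiff (inv ?r \<otimes> r') (lap g) x\<bar> \<le> (\<Sum>r'\<in>R. \<bar>rdiff (inv ?r \<otimes> r') (lap g) (\<nu> x \<otimes> ?r)\<bar>)"
    by (simp add: x_eq sum_abs)
  also have "\<dots> \<le> E g x"
    unfolding E_def using r finite_reps
    by (intro member_le_sum[where f = "\<lambda>r. \<Sum>r'\<in>R. \<bar>rdiff (inv r \<otimes> r') (lap g) (\<nu> x \<otimes> r)\<bar>"])
      (auto intro!: sum_nonneg)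
  finally have diff: "\<bar>\<Sum>r'\<in>R. rdiff (inv ?r \<otimes> r') (lap g) x\<bar> \<le> E g x" .
  have "rdiff (inv ?r \<otimes> r') (lap g) x = lap g (\<nu> x \<otimes> r') - lap g x" if "r' \<in> R" for r'
    using that x by (auto simp: rdiff_def \<nu>_def m_assoc)
  then have "(\<Sum>r'\<in>R. rdiff (inv ?r \<otimes> r') (lap g) x) = F g (\<nu> x) - real (card R) * lap g x"
    using sum_lap_reps[OF \<nu>(1)[OF x], of g] by (simp add: F_def sum_subtractf)
  with diff have "\<bar>real (card R) * lap g x\<bar> \<le> \<bar>F g (\<nu> x)\<bar> + E g x"
    by linarith
  moreover have "real (card R) \<ge> 1"
    using r finite_reps by (simp add: Suc_le_eq card_gt_0_iff) blast
  then have "\<bar>lap g x\<bar> \<le> \<bar>real (card R) * lap g x\<bar>"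
    by (simp add: abs_mult mult_le_cancel_right1)
  ultimately show "\<bar>lap g x\<bar> \<le> \<bar>\<bar>F g (\<nu> x)\<bar> + E g x\<bar>"
    by linarith
qed

end

section \<open>From finite index to the final inequality\<close>

lemma ex_virtually_abelian_heat:
  fixes \<Phi> (structure)
  assumes "group \<Phi>" and N: "N \<lhd> \<Phi>" and comm: "comm_group (\<Phi>\<lparr>carrier := N\<rparr>)"
    and fin: "finite (rcosets N)" and S: "finite S" "symmetric_generating_set \<Phi> (carrier \<Phi>) S"
  shows "\<exists>rep. virtually_abelian_heat \<Phi> S N rep"
proof -
  interpret normal N \<Phi> by (rule N)
  \<comment> \<open>The choice is made from the coset as a set, so equal cosets get equal
    representatives.\<close>
  define rep where "rep = (\<lambda>x. SOME y. y \<in> N #> x)"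
  have rep: "\<exists>h\<in>N. rep x = h \<otimes> x" if "x \<in> carrier \<Phi>" for x
    using someI[of "\<lambda>y. y \<in> N #> x", OF rcos_self[OF that is_subgroup]]
    by (auto simp: rep_def r_coset_def)
  have "rep x \<in> carrier \<Phi>" "x \<otimes> inv (rep x) \<in> N" if x: "x \<in> carrier \<Phi>" for x
  proof -
    obtain h where h: "h \<in> N" "rep x = h \<otimes> x" using rep[OF x] by blast
    then have "x \<otimes> inv (rep x) = inv h"
      using x by (simp add: inv_mult_group flip: m_assoc)
    then show "rep x \<in> carrier \<Phi>" "x \<otimes> inv (rep x) \<in> N"
      using h x by auto
  qed
  moreover have "rep (n \<otimes> x) = rep x" if "n \<in> N" "x \<in> carrier \<Phi>" for n x
    using that coset_mult_assoc[OF subset, of n x] coset_join2[of n N] is_subgroup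
    by (simp add: rep_def)
  moreover have "finite (rep ` carrier \<Phi>)"
  proof (rule finite_surj[OF fin])
    show "rep ` carrier \<Phi> \<subseteq> (\<lambda>c. SOME y. y \<in> c) ` (rcosets N)"
      by (auto simp: rep_def RCOSETS_def)
  qed
  moreover have "m \<otimes> n = n \<otimes> m" if "m \<in> N" "n \<in> N" for m n
    using comm_monoid.m_comm[OF comm_group.axioms(1)[OF comm], of m n] that by simp
  ultimately have "virtually_abelian_heat \<Phi> S N rep"
    using S N by unfold_locales (auto simp: symmetric_generating_set_def)
  then show ?thesis by (rule exI[of _ rep])
qed

text \<open>The square root is 1-Lipschitz on \<open>[1, \<infinity>)\<close>, as
  \<open>a - b\<close> has the factor \<open>sqrt a + sqrt b \<ge> 1\<close>.\<close>

lemma sqrt_diff_power2_le: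
  assumes "a \<ge> 1" "b \<ge> 1"
  shows "(sqrt a - sqrt b)\<^sup>2 \<le> (a - b)\<^sup>2"
proof -
  have "(a - b)\<^sup>2 = (sqrt a - sqrt b)\<^sup>2 * (sqrt a + sqrt b)\<^sup>2"
    using assms by (simp add: algebra_simps flip: power_mult_distrib power2_eq_square)
  moreover have "1 \<le> (sqrt a + sqrt b)\<^sup>2"
    using assms by (intro one_le_power) (simp add: add_increasing2)
  ultimately show ?thesis
    by (simp add: mult_le_cancel_left1)
qed

text \<open>\<open>K = 1\<close> suffices. As \<open>u \<ge> 1\<close>, square roots and divisions
  by \<open>u\<close> cost nothing: the gradient term is a sum of squares of order
  \<open>1 / t\<close>, and the time derivative term equals
  \<open>- lap w / (2 * u)\<close>.\<close>

theorem theorem1p5: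
  fixes \<Phi> :: "('a, 'b) monoid_scheme" and N S T :: "'a set" and k :: nat
  assumes "group \<Phi>"
    and "N \<lhd> \<Phi>"
    and "comm_group (\<Phi>\<lparr>carrier := N\<rparr>)"
    and "finite (rcosets\<^bsub>\<Phi>\<^esub> N)" and "card (rcosets\<^bsub>\<Phi>\<^esub> N) = k"
    and "finite S" and "symmetric_generating_set \<Phi> (carrier \<Phi>) S"
    and "finite T" and "symmetric_generating_set \<Phi> N T"
    and "\<And>g s. g \<in> carrier \<Phi> \<Longrightarrow> s \<in> T \<Longrightarrow> g \<otimes>\<^bsub>\<Phi>\<^esub> s \<otimes>\<^bsub>\<Phi>\<^esub> inv\<^bsub>\<Phi>\<^esub> g \<in> T"
  shows "\<exists>K C :: real. K > 0 \<and> C > 0 \<and>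
    (\<forall>w :: 'a \<Rightarrow> real \<Rightarrow> real.
      (\<forall>x\<in>carrier \<Phi>. \<forall>t\<ge>0. w x t \<in> {0..1}) \<longrightarrow>
      heat_solution (carrier \<Phi>) (cayley_edges \<Phi> S) w \<longrightarrow>
      (let u = (\<lambda>x t. w x t + sqrt (real k)) in
        \<forall>x\<in>carrier \<Phi>. \<forall>t>0.
          graph_gamma (cayley_edges \<Phi> T) (\<lambda>y. sqrt (u y t)) x / (K * u x t)
            - deriv (\<lambda>s. sqrt (u x s)) t / sqrt (u x t) \<le> C / t))"
proof -
  obtain rep where "virtually_abelian_heat \<Phi> S N rep"
    using ex_virtually_abelian_heat[OF assms(1-4,6,7)] by blast
  then interpret virtually_abelian_heat \<Phi> S N rep .
  have T: "T \<subseteq> carrier \<Phi>"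
    using assms(9) by (auto simp: symmetric_generating_set_def)
  have "decays 1 (\<lambda>g x. \<Sum>\<tau>\<in>T. \<bar>rdiff \<tau> g x\<bar>)"
    using T by (intro decays_sum decays_abs decays_rdiff) auto
  then obtain C where C: "C \<ge> 0" "\<And>f B x t. bounded_sol f B \<Longrightarrow> x \<in> carrier \<Phi> \<Longrightarrow> t > 0 \<Longrightarrow>
      \<bar>\<Sum>\<tau>\<in>T. \<bar>rdiff \<tau> (\<lambda>y. f y t) x\<bar>\<bar> \<le> C * B / sqrt t ^ 1"
    unfolding decays_def by blast
  obtain C' where C': "C' \<ge> 0" "\<And>f B x t. bounded_sol f B \<Longrightarrow> x \<in> carrier \<Phi> \<Longrightarrow> t > 0 \<Longrightarrow>
      \<bar>lap (\<lambda>y. f y t) x\<bar> \<le> C' * B / sqrt t ^ 2"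
    using decays_lap unfolding decays_def by blast
  have "carrier \<Phi> \<noteq> {}" using one_closed by blast
  then have "k > 0"
    using assms(4,5) by (auto simp: RCOSETS_def card_gt_0_iff)
  then have k1: "sqrt (real k) \<ge> 1" by simp
  \<comment> \<open>The first summand serves the gradient term and \<open>C'\<close> the time
    derivative; the \<open>1\<close> keeps the constant positive.\<close>
  define D where "D = real (card T) * C\<^sup>2 + C' + 1"
  have "graph_gamma (cayley_edges \<Phi> T) (\<lambda>y. sqrt (w y t + sqrt (real k))) x / (1 * (w x t + sqrt (real k)))
      - deriv (\<lambda>s. sqrt (w x s + sqrt (real k))) t / sqrt (w x t + sqrt (real k)) \<le> D / t"
    if w01: "\<And>x t. x \<in> carrier \<Phi> \<Longrightarrow> t \<ge> 0 \<Longrightarrow> w x t \<in> {0..1}" and sol: "sol w"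
      and x: "x \<in> carrier \<Phi>" and t: "t > 0" for w x t
  proof -
    define u where "u = (\<lambda>x t. w x t + sqrt (real k))"
    have bs: "bounded_sol w 1"
      using sol w01 by (force simp: bounded_sol_def)
    have u1: "u y t \<ge> 1" if "y \<in> carrier \<Phi>" for y
    proof -
      have "w y t \<ge> 0" using w01[OF that, of t] t by simp
      with k1 show ?thesis unfolding u_def by linarith
    qed
    have "(sqrt (u (x \<otimes>\<^bsub>\<Phi>\<^esub> \<tau>) t) - sqrt (u x t))\<^sup>2 \<le> (C / sqrt t)\<^sup>2" if \<tau>: "\<tau> \<in> T" for \<tau>
    proof -
      have "(sqrt (u (x \<otimes>\<^bsub>\<Phi>\<^esub> \<tau>) t) - sqrt (u x t))\<^sup>2 \<le> \<bar>rdiff \<tau> (\<lambda>y. w y t) x\<bar>\<^sup>2"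
        using sqrt_diff_power2_le[OF u1 u1, of "x \<otimes>\<^bsub>\<Phi>\<^esub> \<tau>" x] x \<tau> T
        by (auto simp: u_def rdiff_def)
      also have "\<bar>rdiff \<tau> (\<lambda>y. w y t) x\<bar> \<le> (\<Sum>\<tau>\<in>T. \<bar>rdiff \<tau> (\<lambda>y. w y t) x\<bar>)"
        using \<tau> assms(8) by (intro member_le_sum) auto
      then have "\<bar>rdiff \<tau> (\<lambda>y. w y t) x\<bar>\<^sup>2 \<le> (C / sqrt t)\<^sup>2"
        using C(2)[OF bs x t] by (intro power_mono) auto
      finally show ?thesis .
    qed
    then have "graph_gamma (cayley_edges \<Phi> T) (\<lambda>y. sqrt (u y t)) x \<le> real (card T) * (C / sqrt t)\<^sup>2"
      unfolding graph_gamma_def cayley_sum[OF x T] by (intro sum_bounded_above)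
    also have "\<dots> = real (card T) * C\<^sup>2 / t"
      using t by (simp add: power_divide)
    finally have "graph_gamma (cayley_edges \<Phi> T) (\<lambda>y. sqrt (u y t)) x / u x t \<le> real (card T) * C\<^sup>2 / t / 1"
      using u1[OF x] t by (intro frac_le) (auto simp: graph_gamma_def sum_nonneg)
    moreover have "- deriv (\<lambda>s. sqrt (u x s)) t / sqrt (u x t) \<le> C' / t"
    proof -
      have "at t within {0..} = at t"
        by (rule at_within_interior) (use t in simp)
      then have "(w x has_real_derivative lap (\<lambda>y. w y t) x) (at t)"
        using solD[OF sol x less_imp_le[OF t]] by (simp only:)
      from DERIV_add[OF this DERIV_const[of "sqrt (real k)"]]
      have "(u x has_real_derivative lap (\<lambda>y. w y t) x) (at t)"
        by (simp only: u_def add_0_right)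
      moreover have "u x t > 0" using u1[OF x] by linarith
      ultimately have "((\<lambda>s. sqrt (u x s)) has_real_derivative
          inverse (sqrt (u x t)) / 2 * lap (\<lambda>y. w y t) x) (at t)"
        by (intro DERIV_chain2[OF DERIV_real_sqrt])
      then have "deriv (\<lambda>s. sqrt (u x s)) t = inverse (sqrt (u x t)) / 2 * lap (\<lambda>y. w y t) x"
        by (rule DERIV_imp_deriv)
      moreover have "- (inverse r / 2 * l) / r = - l / (2 * (r * r))" for r l :: real
        by (cases "r = 0") (simp_all add: field_simps)
      moreover have "sqrt (u x t) * sqrt (u x t) = u x t" using u1[OF x] by simp
      ultimately have "- deriv (\<lambda>s. sqrt (u x s)) t / sqrt (u x t) = - lap (\<lambda>y. w y t) x / (2 * u x t)"
        by (simp only:)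
      also have "\<dots> \<le> \<bar>lap (\<lambda>y. w y t) x\<bar> / 1"
        using u1[OF x] by (intro frac_le) auto
      also have "\<dots> \<le> C' / t"
        using C'(2)[OF bs x t] t by simp
      finally show ?thesis .
    qed
    moreover have "1 / t > 0" using t by simp
    ultimately have "graph_gamma (cayley_edges \<Phi> T) (\<lambda>y. sqrt (u y t)) x / u x t
        - deriv (\<lambda>s. sqrt (u x s)) t / sqrt (u x t) \<le> real (card T) * C\<^sup>2 / t + C' / t + 1 / t"
      unfolding minus_divide_left[symmetric] div_by_1 by linarith
    then show ?thesis
      by (simp add: u_def D_def add_divide_distrib)
  qed
  moreover have "D > 0"
    using C'(1) by (simp add: D_def add_nonneg_pos)
  ultimately show ?thesis
    unfolding Let_def by (intro exI[of _ 1] exI[of _ D]) auto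
qed

end
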